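(* For every $r\ge2$ and $t\in\mathbb{C}$ with $|t|<1$, one has $$\frac{1}{\Gamma_{y_r}(1+t)}=\sum_{k\ge0}\zeta(\underbrace{r,\ldots,r}_{k\text{ times}})\,t^{kr}=\exp\Bigl(-\sum_{k\ge1}\zeta(kr)\frac{(-t^r)^{k}}{k}\Bigr)=\prod_{n\ge1}\Bigl(1-\frac{(-t^r)}{n^r}\Bigr).$$
   Context: For integers $s_1\ge2$, $s_2,\ldots,s_m\ge1$, $\zeta(s_1,\ldots,s_m)=\sum_{n_1>\cdots>n_m>0}n_1^{-s_1}\cdots n_m^{-s_m}$, with the empty value (for $k=0$) equal to $1$. For $r\ge2$ and $|z|<1$, $\ell_r(z):=-\sum_{k\ge1}\zeta(kr)\frac{(-z^r)^k}{k}$ and $\Gamma_{y_r}(1+z):=e^{-\ell_r(z)}$. *)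

theory Defs
  imports "HOL-Analysis.Analysis"
begin

text \<open>The index set of a multiple zeta value of depth \<open>m\<close>: the tuples \<open>n\<^sub>1 > \<dots> > n\<^sub>m > 0\<close>.\<close>

definition mzv_indices :: "nat \<Rightarrow> nat list set" where
  "mzv_indices m = {ns. length ns = m \<and> sorted_wrt (>) ns \<and> (\<forall>n\<in>set ns. n > 0)}"

text \<open>The sum of positive terms is unordered.  It is a genuine (convergent) sum when the first
  exponent is at least 2 and the others are at least 1.  For the empty list the index set consists of the
  empty tuple only, and the value is the empty product 1.\<close>

definition mzv :: "nat list \<Rightarrow> real" where
  "mzv s = (\<Sum>\<^sub>\<infinity>ns\<in>mzv_indices (length s). \<Prod>i<length s. 1 / real (ns ! i) ^ (s ! i))"

text \<open>Series over \<open>k \<ge> 1\<close> are indexed by \<open>Suc k\<close>.\<close>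

definition ell :: "nat \<Rightarrow> complex \<Rightarrow> complex" where
  "ell r z = - (\<Sum>k. of_real (mzv [Suc k * r]) * ((- (z ^ r)) ^ Suc k / of_nat (Suc k)))"

text \<open>The function is specified by its value \<open>exp (- ell r z)\<close> at \<open>1 + z\<close>, for \<open>norm z < 1\<close>; outside
  the disc of radius 1 around 1 the value is irrelevant.\<close>

definition Gamma_y :: "nat \<Rightarrow> complex \<Rightarrow> complex" where
  "Gamma_y r w = exp (- ell r (w - 1))"

end

theory Submission
  imports Defs
begin

text \<open>Expanding the product \<open>\<Prod>(1 + x / n\<^sup>r)\<close> with \<open>x = t\<^sup>r\<close> gives a sum over all finite sets of positive
  integers; grouping it by cardinality yields the generating series of the values \<open>\<zeta>(r,\<dots>,r)\<close>.
  Taking the logarithm of each factor and interchanging the two summations turns the same product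
  into the exponential of the power series in \<open>\<zeta>(kr)\<close>.  Both rearrangements are legitimate
  because the double families are absolutely summable for \<open>\<bar>x\<bar> < 1\<close>.\<close>

text \<open>Any finite family of finite sets lies in the power set of its union, where the norms of
  the products sum to a finite product of factors \<open>1 + norm (b n)\<close>. The exponential of
  the total norm bounds this uniformly. The value of the sum is then read off along the sets
  \<open>Pow {..n}\<close>, which give exactly the partial products.\<close>

lemma has_sum_prod_finite_subsets:
  fixes b :: "nat \<Rightarrow> 'a :: {real_normed_field, banach}"
  assumes summable: "summable (\<lambda>n. norm (b n))"
    and has_prod: "(\<lambda>n. 1 + b n) has_prod P"
  shows "((\<lambda>S. prod b S) has_sum P) {S. finite S}"
proof -
  have "(\<lambda>S. prod b S) abs_summable_on {S. finite S}"
  proof (rule nonneg_bdd_above_summable_on)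
    show "bdd_above (sum (\<lambda>S. norm (prod b S)) ` {F. F \<subseteq> {S. finite S} \<and> finite F})"
    proof (rule bdd_aboveI2)
      fix F :: "nat set set" assume F: "F \<in> {F. F \<subseteq> {S. finite S} \<and> finite F}"
      then have fin: "finite (\<Union>F)" by auto
      have "(\<Sum>S\<in>F. norm (prod b S)) \<le> (\<Sum>S\<in>Pow (\<Union>F). norm (prod b S))"
        using fin by (intro sum_mono2) auto
      also have "\<dots> = (\<Prod>n\<in>\<Union>F. norm (b n) + 1)"
        using fin by (subst prod_add) (auto simp: prod_norm)
      also have "\<dots> = (\<Prod>n\<in>\<Union>F. 1 + norm (b n))"
        by (simp add: add.commute)
      also have "\<dots> \<le> exp (\<Sum>n\<in>\<Union>F. norm (b n))"
        by (rule prod_le_exp_sum) simp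
      also have "\<dots> \<le> exp (\<Sum>n. norm (b n))"
        using summable fin by (simp add: sum_le_suminf)
      finally show "(\<Sum>S\<in>F. norm (prod b S)) \<le> exp (\<Sum>n. norm (b n))" .
    qed
  qed auto
  then obtain Q where Q: "((\<lambda>S. prod b S) has_sum Q) {S. finite S}"
    using abs_summable_summable summable_on_def by blast
  \<comment> \<open>Cofinality: every finite family of finite sets is eventually contained in
    \<open>Pow {..n}\<close>, so this single sequence determines the unordered sum.\<close>
  have "filterlim (\<lambda>n. Pow {..n}) (finite_subsets_at_top {S :: nat set. finite S}) sequentially"
    unfolding filterlim_finite_subsets_at_top
  proof (intro allI impI)
    fix X :: "nat set set" assume X: "finite X \<and> X \<subseteq> {S. finite S}"
    then have "finite (\<Union>X)" by auto
    then obtain m where m: "\<Union>X \<subseteq> {..m}"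
      using finite_nat_iff_bounded_le by auto
    show "\<forall>\<^sub>F n in sequentially. finite (Pow {..n}) \<and> X \<subseteq> Pow {..n} \<and> Pow {..n} \<subseteq> {S. finite S}"
      using eventually_ge_at_top[of m]
    proof eventually_elim
      case (elim n)
      then have "\<Union>X \<subseteq> {..n}" using m by fastforce
      then show ?case by (auto intro: finite_subset)
    qed
  qed
  with Q have "(\<lambda>n. \<Sum>S\<in>Pow {..n}. prod b S) \<longlonglongrightarrow> Q"
    unfolding has_sum_def by (rule filterlim_compose)
  moreover have "(\<Sum>S\<in>Pow {..n}. prod b S) = (\<Prod>i\<le>n. 1 + b i)" for n
    using prod_add[of "{..n}" b "\<lambda>_. 1"] by (simp add: add.commute)
  ultimately have "(\<lambda>n. \<Prod>i\<le>n. 1 + b i) \<longlonglongrightarrow> Q"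
    by simp
  then have "Q = P"
    using has_prod_imp_tendsto[OF has_prod] by (rule LIMSEQ_unique)
  with Q show ?thesis by simp
qed

text \<open>Taking real parts shows that the two families are summable together, so the default
  value 0 also occurs on both sides at once.\<close>

lemma infsum_complex_of_real:
  "infsum (\<lambda>x. complex_of_real (f x)) A = of_real (infsum f A)"
proof (rule infsum_bounded_linear_strong)
  show "(\<lambda>x. complex_of_real (f x)) summable_on A \<longleftrightarrow> f summable_on A"
    using summable_on_bounded_linear[OF bounded_linear_Re, of "\<lambda>x. complex_of_real (f x)" A]
      summable_on_of_real[of f A] by auto
qed (rule bounded_linear_of_real)

text \<open>With equal exponents the summand is symmetric in the tuple, and a strictly decreasing
  tuple is determined by its set of entries. Shifting by \<open>Suc\<close> lets \<open>S\<close>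
  range over sets of naturals, matching products indexed from 0.\<close>

lemma mzv_replicate:
  "mzv (replicate k r) = (\<Sum>\<^sub>\<infinity>S\<in>{S. finite S \<and> card S = k}. \<Prod>n\<in>S. 1 / real (Suc n) ^ r)"
proof -
  have "(\<Sum>\<^sub>\<infinity>ns\<in>mzv_indices k. \<Prod>i<k. 1 / real (ns ! i) ^ (replicate k r ! i))
      = (\<Sum>\<^sub>\<infinity>S\<in>{S. finite S \<and> card S = k}. \<Prod>n\<in>S. 1 / real (Suc n) ^ r)"
  proof (rule infsum_reindex_bij_witness[where i = "\<lambda>S. rev (sorted_list_of_set (Suc ` S))"
        and j = "\<lambda>ns. Suc -` set ns"])
    fix ns assume "ns \<in> mzv_indices k"
    then have len: "length ns = k" and sorted: "sorted_wrt (<) (rev ns)" and pos: "0 \<notin> set ns"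
      by (auto simp: mzv_indices_def sorted_wrt_rev)
    from sorted have distinct: "distinct ns" and "sorted (rev ns)"
      by (auto simp: strict_sorted_iff)
    \<comment> \<open>Positivity of the entries makes the preimage under \<open>Suc\<close> lose
      nothing.\<close>
    from pos have Suc_image: "Suc ` (Suc -` set ns) = set ns"
      by (auto simp: image_iff) (metis not0_implies_Suc)
    have "sorted_list_of_set (set ns) = rev ns"
      using \<open>sorted (rev ns)\<close> distinct
      by (metis distinct_rev set_rev sorted_list_of_set.idem_if_sorted_distinct)
    then show "rev (sorted_list_of_set (Suc ` (Suc -` set ns))) = ns"
      unfolding Suc_image by simp
    have "card (Suc -` set ns) = card (set ns)"
      by (metis Suc_image card_image inj_Suc inj_on_subset subset_UNIV)
    then show "Suc -` set ns \<in> {S. finite S \<and> card S = k}"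
      using len distinct by (simp add: finite_vimageI distinct_card)
    have "(\<Prod>n\<in>Suc -` set ns. 1 / real (Suc n) ^ r) = (\<Prod>n\<in>Suc ` (Suc -` set ns). 1 / real n ^ r)"
      by (subst prod.reindex) auto
    also have "\<dots> = (\<Prod>n\<leftarrow>ns. 1 / real n ^ r)"
      unfolding Suc_image using distinct by (rule prod.distinct_set_conv_list)
    also have "\<dots> = (\<Prod>i<k. 1 / real (ns ! i) ^ (replicate k r ! i))"
      using len by (simp add: prod.list_conv_set_nth atLeast0LessThan)
    finally show "(\<Prod>n\<in>Suc -` set ns. 1 / real (Suc n) ^ r)
      = (\<Prod>i<k. 1 / real (ns ! i) ^ (replicate k r ! i))" .
  next
    fix S :: "nat set" assume "S \<in> {S. finite S \<and> card S = k}"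
    then have S: "finite S" "card S = k" by auto
    then show "Suc -` set (rev (sorted_list_of_set (Suc ` S))) = S"
      by (auto simp: inj_vimage_image_eq)
    show "rev (sorted_list_of_set (Suc ` S)) \<in> mzv_indices k"
      using S by (auto simp: mzv_indices_def sorted_wrt_rev card_image)
  qed
  then show ?thesis by (simp add: mzv_def)
qed

lemma mzv_single: "mzv [s] = (\<Sum>\<^sub>\<infinity>n. 1 / real (Suc n) ^ s)"
proof -
  have "mzv [s] = (\<Sum>\<^sub>\<infinity>S\<in>{S. finite S \<and> card S = 1}. \<Prod>n\<in>S. 1 / real (Suc n) ^ s)"
    using mzv_replicate[of 1 s] by simp
  also have "{S :: nat set. finite S \<and> card S = 1} = range (\<lambda>n. {n})"
    by (auto simp: card_1_singleton_iff)
  also have "(\<Sum>\<^sub>\<infinity>S\<in>range (\<lambda>n. {n}). \<Prod>n\<in>S. 1 / real (Suc n) ^ s) = (\<Sum>\<^sub>\<infinity>n. 1 / real (Suc n) ^ s)"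
    by (subst infsum_reindex) (auto simp: o_def)
  finally show ?thesis .
qed

lemma summable_inverse_Suc_power:
  assumes "r \<ge> 2"
  shows "summable (\<lambda>n. 1 / real (Suc n) ^ r)"
  using inverse_power_summable[OF assms, where 'a = real]
  by (subst (asm) summable_Suc_iff[symmetric]) (simp add: field_simps)

lemma has_prod_exp_sums:
  fixes f :: "nat \<Rightarrow> 'a :: {real_normed_field, banach}"
  assumes "f sums s"
  shows "(\<lambda>n. exp (f n)) has_prod exp s"
  using sums_imp_has_prod_exp[OF assms] by (simp add: has_prod_def)

text \<open>In the expansion of the product over finite sets, those of cardinality \<open>k\<close>
  each contribute \<open>x ^ k\<close> times a product of reciprocal powers; together they give the
  coefficient \<open>mzv (replicate k r)\<close>.\<close>

lemma sums_mzv_replicate: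
  fixes x :: complex
  assumes r: "r \<ge> 2" and P: "(\<lambda>n. 1 + x / of_nat (Suc n) ^ r) has_prod P"
  shows "(\<lambda>k. of_real (mzv (replicate k r)) * x ^ k) sums P"
proof -
  define a where "a n = 1 / real (Suc n) ^ r" for n
  define b where "b n = x * of_real (a n)" for n
  have b: "b n = x / of_nat (Suc n) ^ r" for n
    by (simp add: b_def a_def)
  have "norm (b n) = norm x * a n" for n
    by (simp add: b_def a_def norm_mult norm_divide norm_power del: of_nat_Suc)
  then have summable: "summable (\<lambda>n. norm (b n))"
    using summable_mult[OF summable_inverse_Suc_power[OF r], of "norm x"] by (simp only: a_def)
  have "((\<lambda>S. prod b S) has_sum P) {S. finite S}"
    by (rule has_sum_prod_finite_subsets[OF summable]) (simp only: b P)
  \<comment> \<open>Tagging each finite set with its cardinality turns the index set into a disjoint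
    union, so that the sum can be taken fibrewise.\<close>
  moreover have "bij_betw snd (SIGMA k:UNIV. {S. finite S \<and> card S = k}) {S :: nat set. finite S}"
    by (rule bij_betw_byWitness[where f' = "\<lambda>S. (card S, S)"]) auto
  ultimately have "((\<lambda>p. prod b (snd p)) has_sum P) (SIGMA k:UNIV. {S. finite S \<and> card S = k})"
    by (subst has_sum_reindex_bij_betw)
  then have sum: "((\<lambda>(k, S). prod b S) has_sum P) (SIGMA k:UNIV. {S. finite S \<and> card S = k})"
    by (simp add: case_prod_unfold)
  have "((\<lambda>k. \<Sum>\<^sub>\<infinity>S\<in>{S. finite S \<and> card S = k}. prod b S) has_sum P) UNIV"
  proof (rule has_sum_SigmaD[OF sum])
    fix k
    have "(\<lambda>S. prod b S) summable_on {S. finite S \<and> card S = k}"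
      using summable_on_SigmaD1[of "\<lambda>_. prod b"] has_sum_imp_summable[OF sum] by fastforce
    then show "((\<lambda>S. case (k, S) of (k, S) \<Rightarrow> prod b S) has_sum
        (\<Sum>\<^sub>\<infinity>S\<in>{S. finite S \<and> card S = k}. prod b S)) {S. finite S \<and> card S = k}"
      by simp
  qed
  moreover have "(\<Sum>\<^sub>\<infinity>S\<in>{S. finite S \<and> card S = k}. prod b S) = of_real (mzv (replicate k r)) * x ^ k" for k
  proof -
    have "(\<Sum>\<^sub>\<infinity>S\<in>{S. finite S \<and> card S = k}. prod b S)
        = (\<Sum>\<^sub>\<infinity>S\<in>{S. finite S \<and> card S = k}. x ^ k * of_real (prod a S))"
      by (rule infsum_cong) (auto simp: b_def prod.distrib)
    also have "\<dots> = x ^ k * (\<Sum>\<^sub>\<infinity>S\<in>{S. finite S \<and> card S = k}. of_real (prod a S))"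
      by (rule infsum_cmult_right')
    also have "(\<Sum>\<^sub>\<infinity>S\<in>{S. finite S \<and> card S = k}. of_real (prod a S)) = complex_of_real (mzv (replicate k r))"
      by (simp only: mzv_replicate a_def[abs_def] infsum_complex_of_real)
    finally show ?thesis by (simp add: mult.commute)
  qed
  ultimately show ?thesis
    using has_sum_imp_sums by force
qed

text \<open>The double family \<open>f\<close> is absolutely summable, so its total can be computed
  in two orders. Summing over \<open>n\<close> first yields the zeta values in \<open>c\<close>,
  summing over \<open>k\<close> first yields the negated logarithms of the factors.\<close>

lemma mzv_log_series:
  fixes x :: complex
  assumes r: "r \<ge> 2" and x: "norm x < 1"
  defines "c \<equiv> \<lambda>k. of_real (mzv [Suc k * r]) * ((- x) ^ Suc k / of_nat (Suc k))"
  shows "summable c" and "(\<lambda>n. ln (1 + x / of_nat (Suc n) ^ r)) sums (- suminf c)"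
proof -
  define a where "a n = 1 / real (Suc n) ^ r" for n
  \<comment> \<open>Term number \<open>k + 1\<close> of the expansion of
    \<open>- ln (1 + x * a n)\<close>; the sign of \<open>x\<close> absorbs the alternation.\<close>
  define f where "f k n = (- x * of_real (a n)) ^ Suc k / of_nat (Suc k)" for k n
  have a_bounds: "0 \<le> a n" "a n \<le> 1" for n
    by (simp_all add: a_def field_simps)
  have a_summable: "a summable_on UNIV"
    using summable_inverse_Suc_power[OF r] a_bounds(1)
    by (subst summable_on_UNIV_nonneg_real_iff) (simp_all only: a_def[abs_def])
  have "(\<lambda>k. norm x ^ k) summable_on UNIV"
    using x by (subst summable_on_UNIV_nonneg_real_iff) (auto intro: summable_geometric)
  then have dominating: "(\<lambda>(k, n). norm x ^ k * a n) summable_on UNIV \<times> UNIV"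
    using a_bounds(1)
    by (intro summable_on_SigmaI[where g = "\<lambda>k. norm x ^ k * infsum a UNIV"])
       (auto intro!: has_sum_cmult_right summable_on_cmult_left has_sum_infsum a_summable)
  \<comment> \<open>One power of \<open>norm x\<close> and \<open>k\<close> powers of
    \<open>a n\<close> are given up, all of these being at most 1. What remains splits into a
    geometric series in \<open>k\<close> times a convergent series in \<open>n\<close>.\<close>
  have f_bound: "norm (f k n) \<le> norm x ^ k * a n" for k n
  proof -
    have "norm (f k n) = (norm x * a n) ^ Suc k / real (Suc k)"
      using a_bounds(1)
      by (simp add: f_def norm_divide norm_mult norm_power del: of_nat_Suc power_Suc)
    also have "\<dots> \<le> (norm x * a n) ^ Suc k"
      using a_bounds(1)[of n] by (intro divide_left_mono[of 1 "real (Suc k)", simplified div_by_1]) auto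
    also have "\<dots> = norm x ^ Suc k * a n ^ Suc k"
      by (rule power_mult_distrib)
    also have "\<dots> \<le> norm x ^ k * a n"
      using x a_bounds[of n] power_decreasing[of k "Suc k" "norm x"] power_decreasing[of 1 "Suc k" "a n"]
      by (intro mult_mono) auto
    finally show ?thesis .
  qed
  have f_summable: "(\<lambda>(k, n). f k n) summable_on UNIV \<times> UNIV"
    by (rule abs_summable_summable, rule summable_on_comparison_test[OF dominating])
       (auto simp: f_bound)
  have sum_n: "(f k has_sum c k) UNIV" for k
  proof -
    have "f k summable_on UNIV"
      using summable_on_SigmaD1[OF f_summable] by simp
    moreover have "infsum (f k) UNIV = c k"
    proof -
      have "f k n = (- x) ^ Suc k / of_nat (Suc k) * of_real (1 / real (Suc n) ^ (Suc k * r))" for n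
        by (simp add: f_def a_def power_mult_distrib power_divide power_minus' flip: power_mult
            del: of_nat_Suc power_Suc add: mult.commute[of r])
      then have "infsum (f k) UNIV = (\<Sum>\<^sub>\<infinity>n. (- x) ^ Suc k / of_nat (Suc k) * of_real (1 / real (Suc n) ^ (Suc k * r)))"
        by (intro infsum_cong)
      also have "\<dots> = (- x) ^ Suc k / of_nat (Suc k) * of_real (mzv [Suc k * r])"
        by (simp only: infsum_cmult_right' infsum_complex_of_real mzv_single)
      finally show ?thesis by (simp only: c_def mult.commute)
    qed
    ultimately show ?thesis
      using has_sum_infsum by force
  qed
  have sum_k: "((\<lambda>k. f k n) has_sum - ln (1 + x / of_nat (Suc n) ^ r)) UNIV" for n
  proof -
    have "(\<lambda>k. f k n) summable_on UNIV"
      using summable_on_SigmaD1[of "\<lambda>n k. f k n" UNIV "\<lambda>_. UNIV" n] f_summable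
      by (subst (asm) summable_on_swap) simp
    moreover have "(\<lambda>k. f k n) sums - ln (1 + x / of_nat (Suc n) ^ r)"
    proof -
      have "norm (x * of_real (a n)) < 1"
        using x a_bounds[of n] mult_right_le_one_le[of "norm x" "a n"] by (simp add: norm_mult)
      from sums_minus[OF Ln_series'[OF this]]
      have "(\<lambda>k. (- (x * of_real (a n))) ^ k / of_nat k) sums - ln (1 + x * of_real (a n))"
        by simp
      \<comment> \<open>The term at \<open>k = 0\<close> vanishes since it divides by \<open>0\<close>.\<close>
      then have "(\<lambda>k. f k n) sums - ln (1 + x * of_real (a n))"
        using sums_Suc_iff[of "\<lambda>k. (- (x * of_real (a n))) ^ k / of_nat k"]
        by (simp add: f_def del: of_nat_Suc power_Suc)
      then show ?thesis by (simp add: a_def)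
    qed
    ultimately show ?thesis
      by (metis has_sum_imp_sums has_sum_infsum sums_unique2)
  qed
  obtain S where S: "((\<lambda>(k, n). f k n) has_sum S) (UNIV \<times> UNIV)"
    using f_summable by (auto simp: summable_on_def)
  have "(c has_sum S) UNIV"
    using has_sum_SigmaD[OF S] sum_n by simp
  then have "c sums S" by (rule has_sum_imp_sums)
  then show "summable c" by (rule sums_summable)
  \<comment> \<open>The total \<open>S\<close>, already identified as the sum of \<open>c\<close>,
    is now evaluated with \<open>k\<close> as the inner variable.\<close>
  have "((\<lambda>(n, k). f k n) has_sum S) (UNIV \<times> UNIV)"
    using S by (subst (asm) has_sum_swap) simp
  then have "((\<lambda>n. - ln (1 + x / of_nat (Suc n) ^ r)) has_sum S) UNIV"
    by (rule has_sum_SigmaD) (use sum_k in simp)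
  then have "(\<lambda>n. - ln (1 + x / of_nat (Suc n) ^ r)) sums S"
    by (rule has_sum_imp_sums)
  from sums_minus[OF this] show "(\<lambda>n. ln (1 + x / of_nat (Suc n) ^ r)) sums (- suminf c)"
    using \<open>c sums S\<close> by (simp add: sums_iff)
qed

text \<open>The relations \<open>sums\<close> and \<open>has_prod\<close> include convergence,
  whereas \<open>exp\<close> of an infinite sum does not; hence the separate summability claim for
  the exponent.\<close>

theorem corollary2p19:
  fixes r :: nat and t :: complex
  assumes "r \<ge> 2" and "norm t < 1"
  shows "(\<lambda>k. of_real (mzv (replicate k r)) * t ^ (k * r)) sums (1 / Gamma_y r (1 + t))
    \<and> summable (\<lambda>k. of_real (mzv [Suc k * r]) * ((- (t ^ r)) ^ Suc k / of_nat (Suc k)))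
    \<and> 1 / Gamma_y r (1 + t)
        = exp (- (\<Sum>k. of_real (mzv [Suc k * r]) * ((- (t ^ r)) ^ Suc k / of_nat (Suc k))))
    \<and> (\<lambda>n. 1 - (- (t ^ r)) / of_nat (Suc n) ^ r) has_prod (1 / Gamma_y r (1 + t))"
proof -
  let ?x = "t ^ r"
  let ?c = "\<lambda>k. of_real (mzv [Suc k * r]) * ((- ?x) ^ Suc k / of_nat (Suc k))"
  have x: "norm ?x < 1"
    using assms by (simp add: norm_power power_less_one_iff)
  have power_t: "t ^ (k * r) = ?x ^ k" for k
    by (metis mult.commute power_mult)
  \<comment> \<open>Cancelling \<open>exp\<close> against \<open>ln\<close> needs nonzero factors. A
    vanishing factor would force \<open>norm ?x\<close> to equal a power of a positive integer,
    hence to be at least 1.\<close>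
  have nonzero: "1 + ?x / of_nat (Suc n) ^ r \<noteq> 0" for n
  proof
    assume "1 + ?x / of_nat (Suc n) ^ r = 0"
    then have "?x = - (of_nat (Suc n) ^ r)"
      by (simp add: field_simps add_eq_0_iff del: of_nat_Suc)
    then have "norm ?x = real (Suc n) ^ r"
      by (simp only: norm_minus_cancel norm_power norm_of_nat)
    with x show False
      using one_le_power[of "real (Suc n)" r] by linarith
  qed
  \<comment> \<open>The minus sign in \<open>ell\<close> cancels the one in \<open>Gamma_y\<close>,
    so \<open>Gamma_y r (1 + t)\<close> is \<open>exp (suminf ?c)\<close> and the reciprocal
    restores a minus sign.\<close>
  have Gamma: "1 / Gamma_y r (1 + t) = exp (- suminf ?c)"
    by (simp add: Gamma_y_def ell_def exp_minus field_simps)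
  have "(\<lambda>n. exp (ln (1 + ?x / of_nat (Suc n) ^ r))) has_prod exp (- suminf ?c)"
    by (rule has_prod_exp_sums[OF mzv_log_series(2)[OF assms(1) x]])
  then have "(\<lambda>n. 1 + ?x / of_nat (Suc n) ^ r) has_prod (1 / Gamma_y r (1 + t))"
    using nonzero by (simp only: Gamma exp_Ln not_False_eq_True)
  then show ?thesis
    \<comment> \<open>The product value found through logarithms is used as \<open>P\<close>, so the
      series in \<open>mzv (replicate k r)\<close> has the same value.\<close>
    using sums_mzv_replicate[OF assms(1)] mzv_log_series(1)[OF assms(1) x] Gamma power_t
    by (simp only: minus_divide_left [symmetric] diff_minus_eq_add simp_thms)
qed

end
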